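(* For all $n\ge1$, $\mathcal{NC}_n=\mathcal{RF}_n\subseteq\Psi_n$.
   Context: An object is a bounded compact subset $T\subseteq\mathbb{R}^n_+$. For nonempty $S\subseteq[n]$, $T_S$ is the orthogonal projection of $T$ onto the coordinate subspace spanned by the standard basis vectors $v_i$, $i\in S$, and $|T_S|$ its $|S|$-dimensional volume; $\pi(T)\in\mathbb{R}^{2^n-1}$ (when finite) is the vector with entries $\pi(T)_S=\log|T_S|$, $\emptyset\ne S\subseteq[n]$ (convention $\log0=-\infty$). $\Psi_n$ is the set of all vectors in $\mathbb{R}^{2^n-1}$ of the form $\pi(T)$ for an object $T$. Families $\mathcal{A}=\{A_i\}_{i=1}^k$, $\mathcal{B}=\{B_j\}_{j=1}^m$ (repetitions allowed) of nonempty subsets of $[n]$: $\mathcal{A}$ covers $\mathcal{B}$ if (1) for every $e\in[n]$, $|\{i:e\in A_i\}|=|\{j:e\in B_j\}|$, and (2) there is a bijection $f$ from $\{(i,t):t\in A_i\}$ to $\{(j,s):s\in B_j\}$ such that $f(i,t)=(j,s)$ implies $t=s$ and $A_i\subseteq B_j$. $\mathcal{NC}_n=\{\pi\in\mathbb{R}^{2^n-1}: \sum_{j}\pi_{B_j}\le\sum_i\pi_{A_i}$ for all $\mathcal{A},\mathcal{B}$ such that $\mathcal{A}$ covers $\mathcal{B}\}$. A set $F\subseteq\mathbb{R}^n_+$ is cornered if $x\in F$ and $0\le y\le x$ coordinatewise imply $y\in F$. An open rectangle in $(0,\infty)^S$ is a set $\prod_{i\in S}(0,a_i]$. $F\subseteq\mathbb{R}^n_+$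 is a rectangular flower if it is cornered and, for every $S\subseteq[n]$, $F\cap(0,\infty)^S$ is an open rectangle in $(0,\infty)^S$, where $(0,\infty)^S$ denotes the set of points whose coordinates indexed by $S$ are positive and whose other coordinates are $0$. $\mathcal{RF}_n$ is the set of vectors $\pi\in\mathbb{R}^{2^n-1}$ that are the log-projection vector of some rectangular flower. *)

theory Defs
  imports "HOL-Analysis.Analysis"
begin

text \<open>
  The index set \<open>[n]\<close> is the finite (nonempty) type \<^typ>\<open>'n\<close>, so \<open>n\<close> is \<open>CARD('n)\<close>.
  The space of real vectors indexed by the nonempty subsets of \<open>[n]\<close> is represented by
  extensional functions, so that each vector has exactly one representative.
\<close>

definition vector_space_NE :: "('n::finite set \<Rightarrow> real) set" where
  "vector_space_NE = ({S. S \<noteq> {}} \<rightarrow>\<^sub>E UNIV)"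

definition is_object :: "(real ^ 'n::finite) set \<Rightarrow> bool" where
  "is_object T \<longleftrightarrow> bounded T \<and> compact T \<and> T \<subseteq> {x. 0 \<le> x}"

definition coord_proj :: "'n::finite set \<Rightarrow> (real ^ 'n) set \<Rightarrow> (real ^ 'n) set" where
  "coord_proj S T = (\<lambda>x. \<chi> i. if i \<in> S then x $ i else 0) ` T"

text \<open>
  The \<open>card S\<close>-dimensional volume of a subset of the coordinate subspace spanned by the
  standard basis vectors in \<open>S\<close>, which is identified with \<open>\<real>\<^sup>S\<close>.
\<close>

definition coord_vol :: "'n::finite set \<Rightarrow> (real ^ 'n) set \<Rightarrow> real" where
  "coord_vol S X = measure (PiM S (\<lambda>_. lborel)) ((\<lambda>x. \<lambda>i\<in>S. x $ i) ` X)"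

definition log_ext :: "real \<Rightarrow> ereal" where
  "log_ext v = (if v = 0 then - \<infinity> else ereal (ln v))"

text \<open>
  \<open>p\<close> is the log-projection vector of \<open>T\<close>; as \<open>p\<close> is real-valued, this forces every projection
  of \<open>T\<close> onto a nonempty set of coordinates to have nonzero volume.
\<close>

definition is_log_proj_vector :: "('n::finite set \<Rightarrow> real) \<Rightarrow> (real ^ 'n) set \<Rightarrow> bool" where
  "is_log_proj_vector p T \<longleftrightarrow> p \<in> vector_space_NE \<and>
     (\<forall>S. S \<noteq> {} \<longrightarrow> ereal (p S) = log_ext (coord_vol S (coord_proj S T)))"

definition Psi :: "('n::finite set \<Rightarrow> real) set" where
  "Psi = {p. \<exists>T. is_object T \<and> is_log_proj_vector p T}"

definition covers :: "'n::finite set list \<Rightarrow> 'n set list \<Rightarrow> bool" where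
  "covers A B \<longleftrightarrow>
     (\<forall>e. card {i. i < length A \<and> e \<in> A ! i} = card {j. j < length B \<and> e \<in> B ! j}) \<and>
     (\<exists>f. bij_betw f {(i, t). i < length A \<and> t \<in> A ! i} {(j, s). j < length B \<and> s \<in> B ! j} \<and>
        (\<forall>i t j s. i < length A \<and> t \<in> A ! i \<and> f (i, t) = (j, s) \<longrightarrow> t = s \<and> A ! i \<subseteq> B ! j))"

definition NC :: "('n::finite set \<Rightarrow> real) set" where
  "NC = {p \<in> vector_space_NE.
     \<forall>A B. {} \<notin> set A \<and> {} \<notin> set B \<and> covers A B \<longrightarrow>
       (\<Sum>j<length B. p (B ! j)) \<le> (\<Sum>i<length A. p (A ! i))}"

definition cornered :: "(real ^ 'n::finite) set \<Rightarrow> bool" where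
  "cornered F \<longleftrightarrow> (\<forall>x\<in>F. \<forall>y. 0 \<le> y \<and> y \<le> x \<longrightarrow> y \<in> F)"

definition pos_orthant :: "'n::finite set \<Rightarrow> (real ^ 'n) set" where
  "pos_orthant S = {x. (\<forall>i\<in>S. 0 < x $ i) \<and> (\<forall>i. i \<notin> S \<longrightarrow> x $ i = 0)}"

definition is_open_rectangle :: "'n::finite set \<Rightarrow> (real ^ 'n) set \<Rightarrow> bool" where
  "is_open_rectangle S R \<longleftrightarrow>
     (\<exists>a. R = {x. (\<forall>i\<in>S. x $ i \<in> {0<..a i}) \<and> (\<forall>i. i \<notin> S \<longrightarrow> x $ i = 0)})"

definition is_rectangular_flower :: "(real ^ 'n::finite) set \<Rightarrow> bool" where
  "is_rectangular_flower F \<longleftrightarrow> F \<subseteq> {x. 0 \<le> x} \<and> cornered F \<and>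
     (\<forall>S. is_open_rectangle S (F \<inter> pos_orthant S))"

definition RF :: "('n::finite set \<Rightarrow> real) set" where
  "RF = {p. \<exists>F. is_rectangular_flower F \<and> is_log_proj_vector p F}"

end

theory Submission
  imports Defs "HOL-Library.Multiset"
begin

text \<open>
  The petal of a rectangular flower over \<open>S\<close> is a box with side lengths \<open>a S i\<close>, and
  corneredness says exactly that \<open>a S i\<close> decreases as \<open>S\<close> grows. As the projection onto \<open>S\<close> is,
  up to a null set, the petal over \<open>S\<close>, taking logarithms identifies the vectors of rectangular
  flowers with the \<open>p\<close> that split as \<open>p S = (\<Sum>i\<in>S. x S i)\<close> with \<open>x S i\<close> decreasing in \<open>S\<close>. The
  union of the closed petals is compact, so these are vectors of objects.

  The existence of \<open>x\<close> is a linear feasibility problem with integer coefficients. A Farkas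
  certificate of infeasibility consists of the families \<open>\<A>\<close> and \<open>\<B>\<close> of sets whose equations
  are used with positive and negative sign, and, for every \<open>i\<close>, an integral flow from the members of
  \<open>\<A>\<close> containing \<open>i\<close> to those of \<open>\<B>\<close> containing \<open>i\<close> along inclusions. Decomposing the flows
  into paths gives the bijection showing that \<open>\<A>\<close> covers \<open>\<B>\<close>, so the certificate contradicts
  the corresponding inequality in \<open>NC\<close>.
\<close>

section \<open>An integral Farkas lemma\<close>

text \<open>A pair \<open>(c, b)\<close> encodes the inequality with coefficients \<open>c\<close>
  and right-hand side \<open>b\<close>. Adding one row at a time, instead of carrying a vector of
  multipliers, lets certificates be analysed by induction.\<close>

inductive_set nat_cone :: "(('v \<Rightarrow> int) \<times> real) set \<Rightarrow> (('v \<Rightarrow> int) \<times> real) set"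
  for K :: "(('v \<Rightarrow> int) \<times> real) set" where
  zero: "(\<lambda>_. 0, 0) \<in> nat_cone K"
| add: "\<lbrakk>(c, b) \<in> K; (c', b') \<in> nat_cone K\<rbrakk> \<Longrightarrow> (\<lambda>v. c v + c' v, b + b') \<in> nat_cone K"

lemma nat_cone_incl: "(c, b) \<in> K \<Longrightarrow> (c, b) \<in> nat_cone K"
  using nat_cone.add[OF _ nat_cone.zero, of c b K] by simp

lemma nat_cone_plus:
  assumes "(c, b) \<in> nat_cone K" "(c', b') \<in> nat_cone K"
  shows "(\<lambda>v. c v + c' v, b + b') \<in> nat_cone K"
  using assms(1)
proof (induction rule: nat_cone.induct)
  case zero
  then show ?case using assms(2) by simp
next
  case (add d e d' e')
  from nat_cone.add[OF add(1) add(3)] show ?case by (simp add: add.assoc)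
qed

lemma nat_cone_scale:
  assumes "(c, b) \<in> nat_cone K"
  shows "(\<lambda>v. int m * c v, real m * b) \<in> nat_cone K"
proof (induction m)
  case 0
  then show ?case using nat_cone.zero by simp
next
  case (Suc m)
  from nat_cone_plus[OF assms Suc] show ?case by (simp add: algebra_simps)
qed

lemma nat_cone_subset:
  assumes "K' \<subseteq> nat_cone K" "r \<in> nat_cone K'"
  shows "r \<in> nat_cone K"
proof -
  have "(c, b) \<in> nat_cone K" if "(c, b) \<in> nat_cone K'" for c b
    using that
  proof (induction rule: nat_cone.induct)
    case zero
    show ?case by (rule nat_cone.zero)
  next
    case (add c b c' b')
    then show ?case using assms(1) nat_cone_plus by blast
  qed
  then show ?thesis using assms(2) by (cases r) auto
qed

text \<open>Chooses the value of an eliminated variable between its lower bounds \<open>L\<close>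
  and upper bounds \<open>U\<close>, either of which may be absent.\<close>

lemma finite_sets_separation:
  fixes L U :: "real set"
  assumes "finite L" "finite U" "\<And>l u. l \<in> L \<Longrightarrow> u \<in> U \<Longrightarrow> l \<le> u"
  obtains t where "\<And>l. l \<in> L \<Longrightarrow> l \<le> t" "\<And>u. u \<in> U \<Longrightarrow> t \<le> u"
proof (cases "L = {}")
  case True
  show ?thesis
  proof (cases "U = {}")
    case True
    with \<open>L = {}\<close> that show ?thesis by auto
  next
    case False
    with \<open>L = {}\<close> assms that[of "Min U"] show ?thesis by auto
  qed
next
  case False
  with assms that[of "Max L"] show ?thesis by auto
qed

text \<open>
  Fourier--Motzkin elimination; it only ever combines rows with nonnegative integer
  multipliers, hence the certificate of infeasibility is integral although the right-hand
  sides are arbitrary reals.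
\<close>

lemma integral_farkas:
  fixes K :: "(('v \<Rightarrow> int) \<times> real) set"
  assumes "finite V" "finite K"
    and "\<And>c b. (c, b) \<in> nat_cone K \<Longrightarrow> \<forall>v\<in>V. c v = 0 \<Longrightarrow> 0 \<le> b"
  shows "\<exists>x. \<forall>(c, b)\<in>K. (\<Sum>v\<in>V. of_int (c v) * x v) \<le> b"
  using assms
proof (induction V arbitrary: K rule: finite_induct)
  case empty
  have "0 \<le> b" if "(c, b) \<in> K" for c b
    using empty.prems(2)[OF nat_cone_incl[OF that]] by simp
  then show ?case by auto
next
  case (insert v V K)
  define P where "P = {r\<in>K. fst r v > 0}"
  define N where "N = {r\<in>K. fst r v < 0}"
  \<comment> \<open>The multipliers are the absolute values of the two coefficients of
    \<open>v\<close>, so \<open>v\<close> cancels and integrality is kept.\<close>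
  define comb where "comb = (\<lambda>(r, s).
    (\<lambda>u. (- fst s v) * fst r u + fst r v * fst s u,
     of_int (- fst s v) * snd r + of_int (fst r v) * snd s :: real))"
  define K' where "K' = {r\<in>K. fst r v = 0} \<union> comb ` (P \<times> N)"
  have fin: "finite P" "finite N" "finite K'"
    using insert.prems(1) by (auto simp: P_def N_def K'_def)
  have comb_in: "comb (r, s) \<in> nat_cone K" if "r \<in> P" "s \<in> N" for r s
  proof -
    obtain c b c' b' where rs: "r = (c, b)" "s = (c', b')" by (metis surj_pair)
    have "(c, b) \<in> nat_cone K" "(c', b') \<in> nat_cone K"
      using that by (auto simp: rs P_def N_def nat_cone_incl)
    from nat_cone_plus[OF nat_cone_scale[OF this(1), of "nat (- c' v)"]
        nat_cone_scale[OF this(2), of "nat (c v)"]]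
    show ?thesis using that by (simp add: comb_def rs P_def N_def)
  qed
  have K'_sub: "K' \<subseteq> nat_cone K"
    using comb_in nat_cone_incl by (auto simp: K'_def)
  have K'_zero: "fst r v = 0" if "r \<in> K'" for r
    using that by (auto simp: K'_def comb_def)
  \<comment> \<open>The induction hypothesis only speaks of coefficients on \<open>V\<close>; the
    one at \<open>v\<close> has to vanish too before the assumption on \<open>K\<close>
    applies.\<close>
  have cone_zero: "c v = 0" if "(c, b) \<in> nat_cone K'" for c b
    using that by (induction rule: nat_cone.induct) (use K'_zero in fastforce)+
  have "\<exists>x. \<forall>(c, b)\<in>K'. (\<Sum>u\<in>V. of_int (c u) * x u) \<le> b"
  proof (rule insert.IH[OF fin(3)])
    fix c b assume "(c, b) \<in> nat_cone K'" "\<forall>u\<in>V. c u = 0"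
    with cone_zero[of c b] show "0 \<le> b"
      by (intro insert.prems(2)[of c b] nat_cone_subset[OF K'_sub]) auto
  qed
  then obtain x where x: "\<And>r. r \<in> K' \<Longrightarrow> (\<Sum>u\<in>V. of_int (fst r u) * x u) \<le> snd r"
    by fastforce
  \<comment> \<open>\<open>s r\<close> is the slack that \<open>x\<close> leaves in row
    \<open>r\<close> for the term in \<open>v\<close>. Hence \<open>q r\<close> is an upper bound on
    the new value if \<open>r\<close> is in \<open>P\<close> and a lower bound if \<open>r\<close>
    is in \<open>N\<close>.\<close>
  define s where "s r = snd r - (\<Sum>u\<in>V. of_int (fst r u) * x u)" for r :: "('v \<Rightarrow> int) \<times> real"
  define q where "q r = s r / of_int (fst r v)" for r
  have q_le: "q l \<le> q k" if "l \<in> N" "k \<in> P" for k l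
  proof -
    have "comb (k, l) \<in> K'" using that by (auto simp: K'_def)
    from x[OF this]
    have "0 \<le> of_int (- fst l v) * s k + of_int (fst k v) * s l"
      by (simp add: comb_def s_def algebra_simps sum.distrib sum_distrib_left sum_negf sum_subtractf)
    moreover have "fst l v < 0" "fst k v > 0" using that by (auto simp: P_def N_def)
    ultimately show ?thesis by (simp add: q_def field_simps)
  qed
  obtain t where t: "\<And>l. l \<in> N \<Longrightarrow> q l \<le> t" "\<And>k. k \<in> P \<Longrightarrow> t \<le> q k"
    using finite_sets_separation[of "q ` N" "q ` P"] fin q_le
    by (metis (no_types, lifting) finite_imageI imageE imageI)
  have main: "of_int (fst r v) * t \<le> s r" if "r \<in> K" for r
  proof -
    consider "r \<in> N" | "r \<in> P" | "fst r v = 0"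
      using \<open>r \<in> K\<close> by (simp add: P_def N_def) (metis linorder_cases)
    then show ?thesis
    proof cases
      case 1
      then have "fst r v < 0" by (simp add: N_def)
      with t(1)[OF 1] show ?thesis by (simp add: q_def field_simps)
    next
      case 2
      then have "fst r v > 0" by (simp add: P_def)
      with t(2)[OF 2] show ?thesis by (simp add: q_def field_simps)
    next
      case 3
      with that have "r \<in> K'" by (simp add: K'_def)
      from x[OF this] 3 show ?thesis by (simp add: s_def)
    qed
  qed
  have "(\<Sum>u\<in>insert v V. of_int (fst r u) * (x(v := t)) u) \<le> snd r" if "r \<in> K" for r
  proof -
    have "(\<Sum>u\<in>V. of_int (fst r u) * (x(v := t)) u) = (\<Sum>u\<in>V. of_int (fst r u) * x u)"
      using insert.hyps by (intro sum.cong) auto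
    with main[OF that] insert.hyps show ?thesis by (simp add: s_def)
  qed
  then show ?case
    by (intro exI[of _ "x(v := t)"]) (simp add: case_prod_beta del: fun_upd_apply)
qed

section \<open>Matchings of multisets\<close>

text \<open>Say \<open>a\<close> is matched with \<open>c\<close> and \<open>d\<close> with
  \<open>b\<close>. The chain \<open>R d b\<close>, \<open>R b a\<close>, \<open>R a c\<close>
  allows \<open>d\<close> to be matched with \<open>c\<close> once \<open>a\<close> and
  \<open>b\<close> are removed.\<close>

lemma rel_mset_cancel_le:
  assumes "rel_mset R (add_mset a M) (add_mset b N)" "R b a" "transp R"
  shows "rel_mset R M N"
proof -
  obtain c N1 where c: "add_mset b N = add_mset c N1" "R a c" "rel_mset R M N1"
    using msed_rel_invL[OF assms(1)] by blast
  show ?thesis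
  proof (cases "b = c")
    case True
    with c show ?thesis by simp
  next
    case False
    then obtain N2 where N2: "N = add_mset c N2" "N1 = add_mset b N2"
      using c(1) by (auto simp: add_eq_conv_ex)
    obtain d M1 where d: "M = add_mset d M1" "R d b" "rel_mset R M1 N2"
      using msed_rel_invR[OF c(3)[unfolded N2(2)]] by blast
    have "R d c" using d(2) assms(2) c(2) assms(3) by (meson transpD)
    with d show ?thesis by (simp add: N2(1) rel_mset_Plus)
  qed
qed

text \<open>Decomposing an upward flow along the edges \<open>Z\<close> into paths from \<open>M\<close> to \<open>N\<close>.\<close>

lemma rel_mset_of_flow:
  assumes "M + image_mset snd Z = N + image_mset fst Z"
    and "\<And>e. e \<in># Z \<Longrightarrow> R (fst e) (snd e)" "reflp R" "transp R"
  shows "rel_mset R M N"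
  using assms(1,2)
proof (induction Z arbitrary: M N)
  case empty
  then show ?case using assms(3) by (simp add: multiset.rel_refl reflpD)
next
  case (add e Z)
  \<comment> \<open>The edge \<open>e\<close> is cut: its head becomes an extra source and its tail
    an extra target. Cancelling both afterwards splices the paths through \<open>e\<close>
    together.\<close>
  have "rel_mset R (add_mset (snd e) M) (add_mset (fst e) N)"
    using add.prems by (intro add.IH) auto
  then show ?case using rel_mset_cancel_le add.prems(2) assms(4) by fastforce
qed

lemma rel_mset_imp_bij_betw:
  assumes "finite I" "finite J"
    and "rel_mset R (image_mset g (mset_set I)) (image_mset h (mset_set J))"
  shows "\<exists>f. bij_betw f I J \<and> (\<forall>i\<in>I. R (g i) (h (f i)))"
  using assms
proof (induction I arbitrary: J rule: finite_induct)
  case empty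
  then have "J = {}" by (simp add: mset_set_empty_iff)
  then show ?case by (auto simp: bij_betw_def)
next
  case (insert i I J)
  have "rel_mset R (add_mset (g i) (image_mset g (mset_set I))) (image_mset h (mset_set J))"
    using insert.prems(2) insert.hyps by simp
  from msed_rel_invL[OF this] obtain N1 b where
    b: "image_mset h (mset_set J) = add_mset b N1" "R (g i) b"
      "rel_mset R (image_mset g (mset_set I)) N1"
    by blast
  have "b \<in># image_mset h (mset_set J)" by (simp add: b(1))
  \<comment> \<open>Indices with equal values are interchangeable, so any \<open>j\<close> with
    value \<open>b\<close> can serve as the partner of \<open>i\<close>.\<close>
  then obtain j where j: "j \<in> J" "b = h j" using insert.prems(1) by auto
  have "image_mset h (mset_set J) = add_mset (h j) (image_mset h (mset_set (J - {j})))"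
    using mset_set.remove[OF insert.prems(1) j(1)] by simp
  then have "N1 = image_mset h (mset_set (J - {j}))" using b(1) j(2) by simp
  with b(3) insert.IH[of "J - {j}"] insert.prems(1)
  obtain f where f: "bij_betw f I (J - {j})" "\<And>k. k \<in> I \<Longrightarrow> R (g k) (h (f k))" by auto
  have "bij_betw (f(i := j)) I (J - {j})"
    using f(1) insert.hyps(2) by (subst bij_betw_cong[of I _ f]) auto
  then have "bij_betw (f(i := j)) (insert i I) (insert j (J - {j}))"
    using notIn_Un_bij_betw[of i I "f(i := j)" "J - {j}"] insert.hyps(2) by simp
  with j f(2) b(2) insert.hyps(2) show ?case
    by (intro exI[of _ "f(i := j)"]) (auto simp: insert_absorb simp del: fun_upd_apply, auto)
qed

lemma filter_mset_conv_nth: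
  "filter_mset P (mset xs) = image_mset ((!) xs) (mset_set {k. k < length xs \<and> P (xs ! k)})"
proof -
  have "mset xs = image_mset ((!) xs) (mset_set {..<length xs})"
    by (metis atLeast0LessThan map_nth mset_map mset_upt)
  then have "filter_mset P (mset xs) =
      image_mset ((!) xs) (filter_mset (\<lambda>k. P (xs ! k)) (mset_set {..<length xs}))"
    by (simp add: filter_mset_image_mset)
  also have "filter_mset (\<lambda>k. P (xs ! k)) (mset_set {..<length xs}) =
      mset_set {k. k < length xs \<and> P (xs ! k)}"
    by (simp add: filter_mset_mset_set)
  finally show ?thesis .
qed

text \<open>The bijection in \<open>covers\<close> fixes the element component, so it can be
  assembled from one independent bijection of positions per element. Their existence also gives the
  equality of multiplicities.\<close>

lemma covers_if_rel_mset:
  fixes A B :: "'n::finite set list"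
  assumes "\<And>e. rel_mset (\<subseteq>) {#S \<in># mset A. e \<in> S#} {#S \<in># mset B. e \<in> S#}"
  shows "covers A B"
proof -
  define I where "I e = {k. k < length A \<and> e \<in> A ! k}" for e
  define J where "J e = {k. k < length B \<and> e \<in> B ! k}" for e
  have "\<exists>f. bij_betw f (I e) (J e) \<and> (\<forall>i\<in>I e. A ! i \<subseteq> B ! (f i))" for e
    using assms[of e] unfolding filter_mset_conv_nth I_def J_def
    by (intro rel_mset_imp_bij_betw) auto
  then obtain f where f: "\<And>e. bij_betw (f e) (I e) (J e)"
    and sub: "\<And>e i. i \<in> I e \<Longrightarrow> A ! i \<subseteq> B ! (f e i)" by metis
  have inj: "f e i = f e i' \<Longrightarrow> i \<in> I e \<Longrightarrow> i' \<in> I e \<Longrightarrow> i = i'" for e i i'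
    using f[of e] by (auto simp: bij_betw_def inj_on_def)
  have img: "f e ` I e = J e" for e using f[of e] by (simp add: bij_betw_def)
  have "bij_betw (\<lambda>(i, t). (f t i, t)) {(i, t). i < length A \<and> t \<in> A ! i}
    {(j, s). j < length B \<and> s \<in> B ! j}"
    unfolding bij_betw_def
  proof
    show "inj_on (\<lambda>(i, t). (f t i, t)) {(i, t). i < length A \<and> t \<in> A ! i}"
      using inj by (auto simp: inj_on_def I_def)
    show "(\<lambda>(i, t). (f t i, t)) ` {(i, t). i < length A \<and> t \<in> A ! i} =
        {(j, s). j < length B \<and> s \<in> B ! j}"
      using img by (force simp: I_def J_def image_iff set_eq_iff)
  qed
  moreover have "card (I e) = card (J e)" for e using f bij_betw_same_card by blast
  ultimately show ?thesis
    unfolding covers_def using sub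
    by (intro conjI allI exI[of _ "\<lambda>(i, t). (f t i, t)"]) (auto simp: I_def J_def)
qed

section \<open>Monotone splittings\<close>

text \<open>\<open>x S i\<close> is the logarithm of the side in direction \<open>i\<close> of the
  petal over \<open>S\<close>; its values for \<open>i\<close> outside \<open>S\<close> are
  unconstrained.\<close>

definition monotone_splitting :: "('n::finite set \<Rightarrow> 'n \<Rightarrow> real) \<Rightarrow> ('n set \<Rightarrow> real) \<Rightarrow> bool" where
  "monotone_splitting x p \<longleftrightarrow>
     (\<forall>S. S \<noteq> {} \<longrightarrow> p S = (\<Sum>i\<in>S. x S i)) \<and>
     (\<forall>S S' i. i \<in> S \<longrightarrow> S \<subseteq> S' \<longrightarrow> x S' i \<le> x S i)"

text \<open>Both sides expand into sums over incidences of elements and sets. The covering bijection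
  sends each incidence of \<open>A\<close> to one of the same element in a larger set of
  \<open>B\<close>, so monotonicity compares the sums term by term.\<close>

lemma monotone_splitting_imp_NC:
  assumes "p \<in> vector_space_NE" "monotone_splitting x p"
  shows "p \<in> NC"
proof -
  have "(\<Sum>j<length B. p (B ! j)) \<le> (\<Sum>i<length A. p (A ! i))"
    if ne: "{} \<notin> set A" "{} \<notin> set B" and "covers A B" for A B :: "'a set list"
  proof -
    have eq: "(\<Sum>i<length C. p (C ! i)) =
        (\<Sum>(i, t)\<in>{(i, t). i < length C \<and> t \<in> C ! i}. x (C ! i) t)"
      if "{} \<notin> set C" for C :: "'a set list"
    proof -
      have "(\<Sum>i<length C. p (C ! i)) = (\<Sum>i<length C. \<Sum>t\<in>C ! i. x (C ! i) t)"
      proof (rule sum.cong)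
        fix i assume "i \<in> {..<length C}"
        then have "C ! i \<noteq> {}" using that by (metis lessThan_iff nth_mem)
        then show "p (C ! i) = (\<Sum>t\<in>C ! i. x (C ! i) t)"
          using assms(2) by (simp add: monotone_splitting_def)
      qed simp
      also have "\<dots> = (\<Sum>(i, t)\<in>Sigma {..<length C} ((!) C). x (C ! i) t)"
        by (subst sum.Sigma) auto
      also have "Sigma {..<length C} ((!) C) = {(i, t). i < length C \<and> t \<in> C ! i}" by auto
      finally show ?thesis .
    qed
    obtain f where f: "bij_betw f {(i, t). i < length A \<and> t \<in> A ! i}
        {(j, s). j < length B \<and> s \<in> B ! j}"
      and f': "\<And>i t j s. i < length A \<Longrightarrow> t \<in> A ! i \<Longrightarrow> f (i, t) = (j, s) \<Longrightarrow> t = s \<and> A ! i \<subseteq> B ! j"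
      using \<open>covers A B\<close> unfolding covers_def by blast
    have "(\<Sum>(j, s)\<in>{(j, s). j < length B \<and> s \<in> B ! j}. x (B ! j) s) =
        (\<Sum>r\<in>{(i, t). i < length A \<and> t \<in> A ! i}. case f r of (j, s) \<Rightarrow> x (B ! j) s)"
      by (rule sum.reindex_bij_betw[OF f, symmetric])
    also have "\<dots> \<le> (\<Sum>(i, t)\<in>{(i, t). i < length A \<and> t \<in> A ! i}. x (A ! i) t)"
    proof (rule sum_mono, clarify)
      fix i t assume it: "i < length A" "t \<in> A ! i"
      obtain j s where js: "f (i, t) = (j, s)" by fastforce
      from f'[OF it this] assms(2) it
      show "(case f (i, t) of (j, s) \<Rightarrow> x (B ! j) s) \<le> x (A ! i) t"
        unfolding js monotone_splitting_def by auto
    qed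
    finally show ?thesis using eq ne by simp
  qed
  then show ?thesis using assms(1) by (simp add: NC_def)
qed

text \<open>
  The unknowns are the numbers \<open>x S i\<close>, the rows are the two halves of the equation
  \<open>(\<Sum>i\<in>S. x S i) = p S\<close> and the inequalities \<open>x S' i \<le> x S i\<close>.
\<close>

definition sum_row :: "'n::finite set \<Rightarrow> 'n set \<times> 'n \<Rightarrow> int" where
  "sum_row S = (\<lambda>(T, i). of_bool (T = S \<and> i \<in> S))"

definition mono_row :: "'n::finite set \<Rightarrow> 'n set \<Rightarrow> 'n \<Rightarrow> 'n set \<times> 'n \<Rightarrow> int" where
  "mono_row S S' i = (\<lambda>v. of_bool (v = (S', i)) - of_bool (v = (S, i)))"

definition splitting_rows :: "('n::finite set \<Rightarrow> real) \<Rightarrow> (('n set \<times> 'n \<Rightarrow> int) \<times> real) set" where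
  "splitting_rows p =
     (\<lambda>S. (sum_row S, p S)) ` {S. S \<noteq> {}} \<union>
     (\<lambda>S. (\<lambda>v. - sum_row S v, - p S)) ` {S. S \<noteq> {}} \<union>
     (\<lambda>(S, S', i). (mono_row S S' i, 0)) ` {(S, S', i). i \<in> S \<and> S \<subseteq> S'}"

text \<open>\<open>A\<close> and \<open>B\<close> count the equations used with positive and
  negative sign, and \<open>Z i\<close> collects the pairs \<open>(S, S')\<close> of the
  monotonicity rows used at \<open>i\<close>. The coefficient of the unknown at
  \<open>(S, i)\<close> is then the net balance at \<open>S\<close> of the flow \<open>Z i\<close>
  with sources in \<open>A\<close> and sinks in \<open>B\<close>.\<close>

lemma nat_cone_splitting_rows:
  fixes p :: "'n::finite set \<Rightarrow> real"
  assumes "(c, b) \<in> nat_cone (splitting_rows p)"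
  shows "\<exists>A B Z. {} \<notin># A \<and> {} \<notin># B \<and> (\<forall>i. \<forall>e\<in>#Z i. fst e \<subseteq> snd e) \<and>
    b = (\<Sum>S\<in>#A. p S) - (\<Sum>S\<in>#B. p S) \<and>
    (\<forall>S i. c (S, i) =
      int (count {#T \<in># A. i \<in> T#} S) + int (count (image_mset snd (Z i)) S) -
      int (count {#T \<in># B. i \<in> T#} S) - int (count (image_mset fst (Z i)) S))"
  using assms
proof (induction rule: nat_cone.induct)
  case zero
  show ?case by (intro exI[of _ "{#}"] exI[of _ "\<lambda>_. {#}"]) auto
next
  case (add c b c' b')
  then obtain A B Z where IH: "{} \<notin># A" "{} \<notin># B"
    "\<And>i e. e \<in># Z i \<Longrightarrow> fst e \<subseteq> snd e"
    "b' = (\<Sum>S\<in>#A. p S) - (\<Sum>S\<in>#B. p S)"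
    "\<And>S i. c' (S, i) =
      int (count {#T \<in># A. i \<in> T#} S) + int (count (image_mset snd (Z i)) S) -
      int (count {#T \<in># B. i \<in> T#} S) - int (count (image_mset fst (Z i)) S)"
    by blast
  from add.hyps(1) consider
    (pos) S where "S \<noteq> {}" "c = sum_row S" "b = p S"
  | (neg) S where "S \<noteq> {}" "c = (\<lambda>v. - sum_row S v)" "b = - p S"
  | (mono) S S' i where "i \<in> S" "S \<subseteq> S'" "b = 0" "c = mono_row S S' i"
    unfolding splitting_rows_def by auto
  then show ?case
  proof cases
    case pos
    show ?thesis
      by (rule exI[of _ "add_mset S A"], rule exI[of _ B], rule exI[of _ Z]) (use pos IH in \<open>auto simp: sum_row_def\<close>)
  next
    case neg
    show ?thesis
      by (rule exI[of _ A], rule exI[of _ "add_mset S B"], rule exI[of _ Z]) (use neg IH in \<open>auto simp: sum_row_def\<close>)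
  next
    case mono
    show ?thesis
      by (rule exI[of _ A], rule exI[of _ B], rule exI[of _ "Z(i := add_mset (S, S') (Z i))"])
        (use mono IH in \<open>auto simp: mono_row_def\<close>)
  qed
qed

lemma NC_imp_monotone_splitting:
  fixes p :: "'n::finite set \<Rightarrow> real"
  assumes "p \<in> NC"
  obtains x where "monotone_splitting x p"
proof -
  have "\<exists>y. \<forall>(c, b)\<in>splitting_rows p. (\<Sum>v\<in>UNIV. of_int (c v) * y v) \<le> b"
  proof (rule integral_farkas)
    fix c b assume "(c, b) \<in> nat_cone (splitting_rows p)" and c0: "\<forall>v\<in>UNIV. c v = 0"
    from nat_cone_splitting_rows[OF this(1)] obtain A B Z where ne: "{} \<notin># A" "{} \<notin># B"
      and Z: "\<And>i e. e \<in># Z i \<Longrightarrow> fst e \<subseteq> snd e"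
      and b: "b = (\<Sum>S\<in>#A. p S) - (\<Sum>S\<in>#B. p S)"
      and c: "\<And>S i. c (S, i) =
      int (count {#T \<in># A. i \<in> T#} S) + int (count (image_mset snd (Z i)) S) -
      int (count {#T \<in># B. i \<in> T#} S) - int (count (image_mset fst (Z i)) S)"
      by blast
    obtain As Bs where lists: "mset As = A" "mset Bs = B" by (meson ex_mset)
    have "rel_mset (\<subseteq>) {#S \<in># A. i \<in> S#} {#S \<in># B. i \<in> S#}" for i
    proof (rule rel_mset_of_flow)
      \<comment> \<open>Vanishing of all coefficients is flow conservation at every set.\<close>
      show "{#S \<in># A. i \<in> S#} + image_mset snd (Z i) = {#S \<in># B. i \<in> S#} + image_mset fst (Z i)"
      proof (rule multiset_eqI)
        fix S
        show "count ({#S \<in># A. i \<in> S#} + image_mset snd (Z i)) S =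
            count ({#S \<in># B. i \<in> S#} + image_mset fst (Z i)) S"
          using c[of S i] c0 by (simp only: count_union) simp
      qed
    qed (use Z in \<open>auto simp: reflp_def transp_def\<close>)
    then have "covers As Bs" by (intro covers_if_rel_mset) (simp add: lists)
    moreover have "{} \<notin> set As" "{} \<notin> set Bs" using ne lists by auto
    ultimately have "(\<Sum>j<length Bs. p (Bs ! j)) \<le> (\<Sum>i<length As. p (As ! i))"
      using assms unfolding NC_def by blast
    moreover have "(\<Sum>i<length C. p (C ! i)) = (\<Sum>S\<in>#mset C. p S)" for C :: "'n set list"
      by (simp add: sum_list_sum_nth atLeast0LessThan sum_mset_sum_list flip: mset_map)
    ultimately show "0 \<le> b" by (simp add: b lists)
  qed (simp_all add: splitting_rows_def)
  then obtain y where y: "\<And>c b. (c, b) \<in> splitting_rows p \<Longrightarrow>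
      (\<Sum>v\<in>UNIV. of_int (c v) * y v) \<le> b" by blast
  have row: "(\<Sum>v\<in>UNIV. of_int (sum_row S v) * y v) =
      (\<Sum>i\<in>S. y (S, i))" for S
  proof -
    have "(\<Sum>v\<in>UNIV. of_int (sum_row S v) * y v) =
        (\<Sum>v\<in>Pair S ` S. y v)"
      by (rule sum.mono_neutral_cong_right) (auto simp: sum_row_def)
    also have "\<dots> = (\<Sum>i\<in>S. y (S, i))" by (subst sum.reindex) (auto simp: inj_on_def)
    finally show ?thesis .
  qed
  have "p S = (\<Sum>i\<in>S. y (S, i))" if "S \<noteq> {}" for S
  proof (rule antisym)
    have "(\<lambda>v. - sum_row S v, - p S) \<in> splitting_rows p"
      using that unfolding splitting_rows_def by blast
    from y[OF this]
    have "- (\<Sum>v\<in>UNIV. of_int (sum_row S v) * y v) \<le> - p S"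
      by (simp add: sum_negf)
    then show "p S \<le> (\<Sum>i\<in>S. y (S, i))" unfolding row by simp
    have "(sum_row S, p S) \<in> splitting_rows p"
      using that unfolding splitting_rows_def by blast
    from y[OF this] show "(\<Sum>i\<in>S. y (S, i)) \<le> p S" unfolding row .
  qed
  moreover have "y (S', i) \<le> y (S, i)" if "i \<in> S" "S \<subseteq> S'" for S S' i
  proof -
    have "(mono_row S S' i, 0) \<in> splitting_rows p"
      using that unfolding splitting_rows_def
      by (intro UnI2 image_eqI[of _ _ "(S, S', i)"]) auto
    from y[OF this]
    have "(\<Sum>v\<in>UNIV. of_bool (v = (S', i)) * y v) \<le> (\<Sum>v\<in>UNIV. of_bool (v = (S, i)) * y v)"
      by (simp add: mono_row_def left_diff_distrib sum_subtractf)
    then show ?thesis by simp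
  qed
  ultimately have "monotone_splitting (\<lambda>S i. y (S, i)) p"
    by (auto simp: monotone_splitting_def)
  then show ?thesis by (rule that)
qed

section \<open>Rectangular flowers\<close>

lemma emeasure_PiM_lborel_PiE:
  assumes "finite S" "\<And>i. i \<in> S \<Longrightarrow> X i \<in> sets borel"
  shows "emeasure (PiM S (\<lambda>_. lborel :: real measure)) (PiE S X) = (\<Prod>i\<in>S. emeasure lborel (X i))"
proof -
  interpret product_sigma_finite "\<lambda>_. lborel :: real measure" by unfold_locales
  show ?thesis using assms by (intro emeasure_PiM) auto
qed

text \<open>By corneredness, projecting onto \<open>S\<close> gives the points of \<open>F\<close>
  that vanish outside \<open>S\<close>. These are sorted by their support \<open>S'\<close>.\<close>

lemma image_coord_proj_flower:
  fixes F :: "(real ^ 'n::finite) set"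
  assumes nonneg: "F \<subseteq> {x. 0 \<le> x}" and corn: "cornered F"
    and rect: "\<And>S. F \<inter> pos_orthant S =
      {x. (\<forall>i\<in>S. x $ i \<in> {0<..a S i}) \<and> (\<forall>i. i \<notin> S \<longrightarrow> x $ i = 0)}"
  shows "(\<lambda>x. \<lambda>i\<in>S. x $ i) ` coord_proj S F =
    (\<Union>S'\<in>Pow S. PiE S (\<lambda>i. if i \<in> S' then {0<..a S' i} else {0}))"
proof (intro equalityI subsetI)
  fix g assume "g \<in> (\<lambda>x. \<lambda>i\<in>S. x $ i) ` coord_proj S F"
  then obtain y where y: "y \<in> F" and g: "g = (\<lambda>i\<in>S. y $ i)"
    by (auto simp: coord_proj_def restrict_def fun_eq_iff)
  define z where "z = (\<chi> i. if i \<in> S then y $ i else 0)"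
  define S' where "S' = {i\<in>S. y $ i > 0}"
  have y0: "0 \<le> y $ i" for i using nonneg y by (auto simp: less_eq_vec_def)
  have "z \<in> F"
    using corn y y0 unfolding cornered_def by (auto simp: z_def less_eq_vec_def)
  moreover have "z \<in> pos_orthant S'"
    using y0 by (auto simp: pos_orthant_def z_def S'_def) (metis less_eq_real_def)
  ultimately have "\<forall>i\<in>S'. z $ i \<in> {0<..a S' i}" using rect[of S'] by blast
  then have "g \<in> PiE S (\<lambda>i. if i \<in> S' then {0<..a S' i} else {0})"
    using y0 by (auto simp: g z_def S'_def) (metis less_eq_real_def)
  then show "g \<in> (\<Union>S'\<in>Pow S. PiE S (\<lambda>i. if i \<in> S' then {0<..a S' i} else {0}))"
    by (intro UN_I[of S']) (auto simp: S'_def)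
next
  fix g assume "g \<in> (\<Union>S'\<in>Pow S. PiE S (\<lambda>i. if i \<in> S' then {0<..a S' i} else {0}))"
  then obtain S' where S': "S' \<subseteq> S" "g \<in> PiE S (\<lambda>i. if i \<in> S' then {0<..a S' i} else {0})"
    by blast
  define y :: "real ^ 'n" where "y = (\<chi> i. if i \<in> S then g i else 0)"
  have gi: "g i \<in> (if i \<in> S' then {0<..a S' i} else {0})" if "i \<in> S" for i
    using S'(2) that by (rule PiE_mem)
  have "\<forall>i\<in>S'. y $ i \<in> {0<..a S' i}"
    using S'(1) gi by (fastforce simp: y_def)
  moreover have "y $ i = 0" if "i \<notin> S'" for i using gi[of i] that by (auto simp: y_def)
  ultimately have "y \<in> F" using rect[of S'] by blast
  have "y = (\<chi> i. if i \<in> S then y $ i else 0)" by (simp add: y_def vec_eq_iff)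
  with \<open>y \<in> F\<close> have "y \<in> coord_proj S F" unfolding coord_proj_def by blast
  moreover have "g = (\<lambda>i\<in>S. y $ i)"
  proof
    fix i
    show "g i = (\<lambda>i\<in>S. y $ i) i" using PiE_arb[OF S'(2), of i] by (simp add: y_def)
  qed
  ultimately show "g \<in> (\<lambda>x. \<lambda>i\<in>S. x $ i) ` coord_proj S F" by blast
qed

text \<open>A piece with support \<open>S'\<close> strictly inside \<open>S\<close> has a factor
  \<open>{0}\<close> and is null, so only the petal over \<open>S\<close> contributes. The
  \<open>max 0\<close> accounts for empty intervals when \<open>a S i\<close> is not
  positive.\<close>

lemma coord_vol_flower:
  fixes F :: "(real ^ 'n::finite) set"
  assumes "F \<subseteq> {x. 0 \<le> x}" "cornered F"
    and "\<And>S. F \<inter> pos_orthant S =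
      {x. (\<forall>i\<in>S. x $ i \<in> {0<..a S i}) \<and> (\<forall>i. i \<notin> S \<longrightarrow> x $ i = 0)}"
  shows "coord_vol S (coord_proj S F) = (\<Prod>i\<in>S. max 0 (a S i))"
proof -
  let ?M = "PiM S (\<lambda>_. lborel :: real measure)"
  define Q where "Q S' = PiE S (\<lambda>i. if i \<in> S' then {0<..a S' i} else {0})" for S'
  have Q_sets: "Q S' \<in> sets ?M" for S'
    unfolding Q_def by (rule sets_PiM_I_finite) auto
  have "Q S' \<in> null_sets ?M" if "S' \<subset> S" for S'
  proof -
    obtain i where i: "i \<in> S" "i \<notin> S'" using \<open>S' \<subset> S\<close> by blast
    have "emeasure ?M (Q S') = (\<Prod>i\<in>S. emeasure lborel (if i \<in> S' then {0<..a S' i} else {0}))"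
      unfolding Q_def by (rule emeasure_PiM_lborel_PiE) auto
    also have "\<dots> = 0" using i by (intro prod_zero) auto
    finally show ?thesis using Q_sets by (simp add: null_sets_def)
  qed
  then have null: "(\<Union>S'\<in>Pow S - {S}. Q S') \<in> null_sets ?M"
    by (intro null_sets_UN') (auto simp: countable_finite)
  have "(\<lambda>x. \<lambda>i\<in>S. x $ i) ` coord_proj S F = (\<Union>S'\<in>Pow S. Q S')"
    unfolding Q_def by (rule image_coord_proj_flower[OF assms])
  also have "\<dots> = Q S \<union> (\<Union>S'\<in>Pow S - {S}. Q S')" by auto
  finally have "coord_vol S (coord_proj S F) = measure ?M (Q S)"
    unfolding coord_vol_def using emeasure_Un_null_set[OF Q_sets null] by (simp add: measure_def)
  moreover have "emeasure ?M (Q S) = ennreal (\<Prod>i\<in>S. max 0 (a S i))"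
  proof -
    have "emeasure ?M (Q S) = (\<Prod>i\<in>S. emeasure lborel (if i \<in> S then {0<..a S i} else {0}))"
      unfolding Q_def by (rule emeasure_PiM_lborel_PiE) auto
    also have "\<dots> = (\<Prod>i\<in>S. ennreal (max 0 (a S i)))"
      by (intro prod.cong) (auto simp: max_def)
    also have "\<dots> = ennreal (\<Prod>i\<in>S. max 0 (a S i))" by (rule prod_ennreal) simp
    finally show ?thesis .
  qed
  ultimately show ?thesis by (simp add: measure_def prod_nonneg)
qed

lemma RF_imp_monotone_splitting:
  assumes "p \<in> RF"
  obtains x where "monotone_splitting x p"
proof -
  obtain F where F: "is_rectangular_flower F" "is_log_proj_vector p F"
    using assms by (auto simp: RF_def)
  have nn: "F \<subseteq> {x. 0 \<le> x}" and corn: "cornered F"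
    using F(1) by (auto simp: is_rectangular_flower_def)
  have "\<forall>S. \<exists>a. F \<inter> pos_orthant S =
      {x. (\<forall>i\<in>S. x $ i \<in> {0<..a i}) \<and> (\<forall>i. i \<notin> S \<longrightarrow> x $ i = 0)}"
    using F(1) by (simp add: is_rectangular_flower_def is_open_rectangle_def)
  from choice[OF this] obtain a where a: "\<And>S. F \<inter> pos_orthant S =
      {x. (\<forall>i\<in>S. x $ i \<in> {0<..a S i}) \<and> (\<forall>i. i \<notin> S \<longrightarrow> x $ i = 0)}"
    by blast
  have log: "ereal (p S) = log_ext (\<Prod>i\<in>S. max 0 (a S i))" if "S \<noteq> {}" for S
    using F(2) that by (simp add: is_log_proj_vector_def coord_vol_flower[OF nn corn a])
  \<comment> \<open>A nonpositive side would give volume zero, whose logarithm is not the real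
    number \<open>p S\<close>.\<close>
  have pos: "0 < a S i" if "i \<in> S" for S i
  proof (rule ccontr)
    assume "\<not> 0 < a S i"
    then have "(\<Prod>i\<in>S. max 0 (a S i)) = 0" using that by (intro prod_zero bexI[of _ i]) auto
    with log[of S] that show False by (auto simp: log_ext_def)
  qed
  have "p S = (\<Sum>i\<in>S. ln (a S i))" if "S \<noteq> {}" for S
  proof -
    have eq: "(\<Prod>i\<in>S. max 0 (a S i)) = (\<Prod>i\<in>S. a S i)"
      using pos by (intro prod.cong) (auto simp: max_def less_eq_real_def)
    have "(\<Prod>i\<in>S. a S i) > 0" using pos by (simp add: prod_pos)
    with log[OF that] have "p S = ln (\<Prod>i\<in>S. a S i)"
      unfolding eq log_ext_def by (metis ereal.inject less_irrefl)
    also have "\<dots> = (\<Sum>i\<in>S. ln (a S i))" by (intro ln_prod) (simp_all add: pos less_imp_neq[symmetric])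
    finally show ?thesis .
  qed
  moreover have "ln (a S' i) \<le> ln (a S i)" if "i \<in> S" "S \<subseteq> S'" for S S' i
  proof -
    \<comment> \<open>\<open>y\<close> is the outer corner of the petal over \<open>S'\<close>. Its
      projection \<open>z\<close> stays in \<open>F\<close> by corneredness, so its coordinates are
      bounded by the sides of the petal over \<open>S\<close>.\<close>
    define y where "y = (\<chi> j. if j \<in> S' then a S' j else 0)"
    define z where "z = (\<chi> j. if j \<in> S then a S' j else 0)"
    have "y \<in> F" using a[of S'] pos by (auto simp: y_def)
    moreover have "0 \<le> z" "z \<le> y"
      using that(2) pos by (auto simp: y_def z_def less_eq_vec_def intro!: less_imp_le)
    ultimately have "z \<in> F" using corn by (auto simp: cornered_def)
    moreover have "z \<in> pos_orthant S" using that(2) pos by (auto simp: z_def pos_orthant_def)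
    ultimately have "z $ i \<in> {0<..a S i}" using a[of S] that(1) by blast
    then show ?thesis using that(1) by (simp add: z_def)
  qed
  ultimately have "monotone_splitting (\<lambda>S i. ln (a S i)) p" by (simp add: monotone_splitting_def)
  then show ?thesis by (rule that)
qed

text \<open>A finite union of closed boxes \<open>{0..u S}\<close> is compact. A point with support
  \<open>S\<close> lies only in boxes with \<open>S\<close> \<subseteq> \<open>S'\<close>, and
  monotonicity puts those bounds below \<open>a S i\<close>, so larger boxes do not enlarge the
  petal over \<open>S\<close>.\<close>

lemma monotone_splitting_imp_flower:
  fixes p :: "'n::finite set \<Rightarrow> real"
  assumes "p \<in> vector_space_NE" "monotone_splitting x p"
  obtains F where "is_rectangular_flower F" "is_object F" "is_log_proj_vector p F"
proof -
  define a where "a S i = exp (x S i)" for S i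
  define u :: "'n set \<Rightarrow> real ^ 'n" where "u S = (\<chi> i. if i \<in> S then a S i else 0)" for S
  define F where "F = (\<Union>S. {0..u S})"
  have nn: "F \<subseteq> {x. 0 \<le> x}" by (auto simp: F_def)
  have corn: "cornered F" unfolding cornered_def F_def by (auto dest: order_trans)
  have a_mono: "a S' i \<le> a S i" if "i \<in> S" "S \<subseteq> S'" for S S' i
    using assms(2) that by (auto simp: a_def monotone_splitting_def)
  have rect: "F \<inter> pos_orthant S =
      {x. (\<forall>i\<in>S. x $ i \<in> {0<..a S i}) \<and> (\<forall>i. i \<notin> S \<longrightarrow> x $ i = 0)}" (is "_ = ?R") for S
  proof (intro equalityI subsetI)
    fix y assume y: "y \<in> F \<inter> pos_orthant S"
    then obtain S' where S': "y \<le> u S'" by (auto simp: F_def)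
    have le: "y $ i \<le> (if i \<in> S' then a S' i else 0)" for i
      using S' by (auto simp: less_eq_vec_def u_def)
    have yp: "\<And>i. i \<in> S \<Longrightarrow> 0 < y $ i" "\<And>i. i \<notin> S \<Longrightarrow> y $ i = 0"
      using y by (auto simp: pos_orthant_def)
    have sub: "S \<subseteq> S'"
    proof
      fix i assume "i \<in> S"
      with le[of i] yp(1)[of i] show "i \<in> S'" by (auto split: if_splits)
    qed
    have "y $ i \<le> a S i" if "i \<in> S" for i
    proof -
      have "y $ i \<le> a S' i" using le[of i] sub that by auto
      also have "\<dots> \<le> a S i" using that sub by (rule a_mono)
      finally show ?thesis .
    qed
    with yp show "y \<in> ?R" by auto
  next
    fix y assume "y \<in> ?R"
    then have "y \<in> {0..u S}" "y \<in> pos_orthant S"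
      by (auto simp: less_eq_vec_def u_def pos_orthant_def) (metis less_eq_real_def)
    then show "y \<in> F \<inter> pos_orthant S" by (auto simp: F_def)
  qed
  have "is_rectangular_flower F"
    using nn corn rect unfolding is_rectangular_flower_def is_open_rectangle_def by blast
  moreover have "compact F"
    unfolding F_def by (intro compact_UN) (auto simp: interval_cbox)
  then have "is_object F" using nn by (simp add: is_object_def compact_imp_bounded)
  moreover have "is_log_proj_vector p F"
    unfolding is_log_proj_vector_def
  proof (intro conjI allI impI assms(1))
    fix S :: "'n set" assume "S \<noteq> {}"
    have "coord_vol S (coord_proj S F) = (\<Prod>i\<in>S. exp (x S i))"
      unfolding coord_vol_flower[OF nn corn rect]
      by (intro prod.cong) (auto simp: a_def max_def less_eq_real_def)
    also have "\<dots> = exp (p S)"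
      using assms(2) \<open>S \<noteq> {}\<close> by (simp add: exp_sum monotone_splitting_def)
    finally show "ereal (p S) = log_ext (coord_vol S (coord_proj S F))"
      by (simp add: log_ext_def)
  qed
  ultimately show ?thesis by (rule that)
qed

theorem theorem3:
  shows "(NC :: ('n::finite set \<Rightarrow> real) set) = RF \<and> (RF :: ('n set \<Rightarrow> real) set) \<subseteq> Psi"
proof -
  have RF_NE: "p \<in> vector_space_NE" if "p \<in> RF" for p :: "'n set \<Rightarrow> real"
    using that by (auto simp: RF_def is_log_proj_vector_def)
  have "p \<in> RF" if "p \<in> NC" for p :: "'n set \<Rightarrow> real"
  proof -
    have "p \<in> vector_space_NE" using that by (simp add: NC_def)
    with NC_imp_monotone_splitting[OF that] show ?thesis
      unfolding RF_def by (blast elim: monotone_splitting_imp_flower)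
  qed
  moreover have "p \<in> NC" if "p \<in> RF" for p :: "'n set \<Rightarrow> real"
    using RF_imp_monotone_splitting[OF that] monotone_splitting_imp_NC[OF RF_NE[OF that]] by blast
  \<comment> \<open>The given flower is not itself shown to be compact; a compact one is rebuilt
    from its splitting.\<close>
  moreover have "p \<in> Psi" if "p \<in> RF" for p :: "'n set \<Rightarrow> real"
    using RF_imp_monotone_splitting[OF that] RF_NE[OF that]
    unfolding Psi_def by (blast elim: monotone_splitting_imp_flower)
  ultimately show ?thesis by blast
qed

end
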